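(* Let $\alpha,\beta\in[-1,1]$ with $\alpha^2+\beta^2=1$ and $\beta\neq0$, and let $\alpha_0=1$, $\beta_0=0$, $\alpha_n=\alpha$ and $\beta_n=\beta$ for all $n\ge1$. Let $0\le\lambda\le1$, let $\psi$ be the diagonal state $\psi(y)=\lambda y_{1,1}+(1-\lambda)y_{2,2}$ on $M_2(\mathbb C)$, and let $T_\psi$ be the associated transition operator on $\mathcal B(\mathcal H)$, $\mathcal H=\ell^2(\mathbb N)$. Then $T_\psi$ is weakly mixing (hence ergodic) if and only if $\lambda\le\frac12$. For $\lambda>\frac12$ the fixed space of $T_\psi$ is infinite dimensional.
   Context: $\mathbb N$ includes $0$. $\mathcal H=\ell^2(\mathbb N)$ has canonical orthonormal basis $(e_n)_{n\in\mathbb N}$; $\mathbf 1$ is the identity operator. Let $a,b\in\mathcal B(\mathcal H)$ be the diagonal operators $a e_n=\alpha_n e_n$, $b e_n=\beta_n e_n$, and let $s$ be the isometric shift $s e_n=e_{n+1}$. Writing operators on $\mathcal H\otimes\mathbb C^2$ as $2\times2$ matrices with entries in $\mathcal B(\mathcal H)$ (so $x\otimes y=(y_{i,j}x)_{i,j}$), define the unitary $$u=\begin{pmatrix} s^*as & i s^*b\\ i bs & a\end{pmatrix}.$$ For a state $\psi$ on $M_2=M_2(\mathbb C)$ let $P_\psi:\mathcal B(\mathcal H\otimes\mathbb C^2)\to\mathcal B(\mathcal H)$ be the linear extension of $P_\psi(x\otimes y)=\psi(y)x$. The transition operator associated with $\psi$ is $T_\psi(x)=P_\psi\bigl(u^*(x\otimes\mathbf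 1)u\bigr)$, $x\in\mathcal B(\mathcal H)$. The fixed space of $T$ is $\{x\in\mathcal B(\mathcal H):T(x)=x\}$. $T$ is ergodic if its fixed space is $\mathbb C\mathbf 1$; $T$ is weakly mixing if $T(x)=\mu x$ with $\mu\in\mathbb C$, $|\mu|=1$, implies $x\in\mathbb C\mathbf 1$. *)

theory Defs
  imports "HOL-Analysis.Analysis"
begin

section \<open>Complex vector spaces\<close>

class complex_vector = ab_group_add +
  fixes scaleC :: "complex \<Rightarrow> 'a \<Rightarrow> 'a" (infixr "*\<^sub>C" 75)
  assumes scaleC_add_right: "c *\<^sub>C (x + y) = c *\<^sub>C x + c *\<^sub>C y"
    and scaleC_add_left: "(c + d) *\<^sub>C x = c *\<^sub>C x + d *\<^sub>C x"
    and scaleC_scaleC: "c *\<^sub>C d *\<^sub>C x = (c * d) *\<^sub>C x"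
    and scaleC_one: "1 *\<^sub>C x = x"

global_interpretation complex_vector: vector_space "scaleC :: complex \<Rightarrow> 'a \<Rightarrow> 'a::complex_vector"
  by unfold_locales (simp_all add: scaleC_add_right scaleC_add_left scaleC_scaleC scaleC_one)

text \<open>Intended for subspaces \<open>V\<close>: a set that is not a subspace is never finite-dimensional here.\<close>

definition finite_dimensionalC :: "'a::complex_vector set \<Rightarrow> bool" where
  "finite_dimensionalC V \<longleftrightarrow> (\<exists>B. finite B \<and> V = module.span scaleC B)"


section \<open>The Hilbert space of square-summable sequences\<close>

typedef ell2 = "{x :: nat \<Rightarrow> complex. summable (\<lambda>n. (cmod (x n))\<^sup>2)}"
  morphisms coord Abs_ell2
  by (rule exI[of _ "\<lambda>_. 0"]) simp

setup_lifting type_definition_ell2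

lemma ell2_eqI: "(\<And>n. coord x n = coord y n) \<Longrightarrow> x = y"
  by (simp add: coord_inject[symmetric] fun_eq_iff)

lemma summable_coord: "summable (\<lambda>n. (cmod (coord x n))\<^sup>2)"
  using coord[of x] by simp

lemma ell2_summable_add:
  assumes "summable (\<lambda>n. (cmod (x n))\<^sup>2)" and "summable (\<lambda>n. (cmod (y n))\<^sup>2)"
  shows "summable (\<lambda>n. (cmod (x n + y n))\<^sup>2)"
proof (rule summable_comparison_test')
  show "summable (\<lambda>n. 2 * ((cmod (x n))\<^sup>2 + (cmod (y n))\<^sup>2))"
    by (intro summable_mult summable_add assms)
  fix n
  have "(cmod (x n + y n))\<^sup>2 \<le> (cmod (x n) + cmod (y n))\<^sup>2"
    by (intro power_mono norm_triangle_ineq) auto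
  also have "\<dots> \<le> 2 * ((cmod (x n))\<^sup>2 + (cmod (y n))\<^sup>2)"
    using zero_le_power2[of "cmod (x n) - cmod (y n)"] by (simp add: power2_eq_square algebra_simps)
  finally show "norm ((cmod (x n + y n))\<^sup>2) \<le> 2 * ((cmod (x n))\<^sup>2 + (cmod (y n))\<^sup>2)"
    by simp
qed

lemma ell2_summable_mult:
  assumes "summable (\<lambda>n. (cmod (x n))\<^sup>2)"
  shows "summable (\<lambda>n. (cmod (c * x n))\<^sup>2)"
  using summable_mult[OF assms, of "(cmod c)\<^sup>2"] by (simp add: norm_mult power_mult_distrib)

lemma ell2_summable_cnj_mult: "summable (\<lambda>n. cnj (coord x n) * coord y n)"
proof (rule summable_comparison_test')
  show "summable (\<lambda>n. (cmod (coord x n))\<^sup>2 + (cmod (coord y n))\<^sup>2)"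
    by (intro summable_add summable_coord)
  fix n
  have "2 * (cmod (coord x n) * cmod (coord y n)) \<le> (cmod (coord x n))\<^sup>2 + (cmod (coord y n))\<^sup>2"
    using sum_squares_bound[of "cmod (coord x n)" "cmod (coord y n)"] by simp
  moreover have "0 \<le> cmod (coord x n) * cmod (coord y n)" by simp
  ultimately show "norm (cnj (coord x n) * coord y n) \<le> (cmod (coord x n))\<^sup>2 + (cmod (coord y n))\<^sup>2"
    unfolding norm_mult complex_mod_cnj by linarith
qed

instantiation ell2 :: real_vector
begin

lift_definition zero_ell2 :: ell2 is "\<lambda>_. 0" by simp
lift_definition plus_ell2 :: "ell2 \<Rightarrow> ell2 \<Rightarrow> ell2" is "\<lambda>x y n. x n + y n"
  by (rule ell2_summable_add)
lift_definition uminus_ell2 :: "ell2 \<Rightarrow> ell2" is "\<lambda>x n. - x n" by simp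
lift_definition minus_ell2 :: "ell2 \<Rightarrow> ell2 \<Rightarrow> ell2" is "\<lambda>x y n. x n - y n"
proof -
  fix x y :: "nat \<Rightarrow> complex"
  assume "summable (\<lambda>n. (cmod (x n))\<^sup>2)" "summable (\<lambda>n. (cmod (y n))\<^sup>2)"
  then show "summable (\<lambda>n. (cmod (x n - y n))\<^sup>2)"
    using ell2_summable_add[of x "\<lambda>n. - y n"] by simp
qed
lift_definition scaleR_ell2 :: "real \<Rightarrow> ell2 \<Rightarrow> ell2" is "\<lambda>r x n. complex_of_real r * x n"
  by (rule ell2_summable_mult)

instance
  by standard (transfer; simp add: fun_eq_iff algebra_simps)+

end

instantiation ell2 :: complex_vector
begin

lift_definition scaleC_ell2 :: "complex \<Rightarrow> ell2 \<Rightarrow> ell2" is "\<lambda>c x n. c * x n"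
  by (rule ell2_summable_mult)

instance
  by standard (transfer; simp add: fun_eq_iff algebra_simps)+

end

lemma coord_simps [simp]:
  "coord 0 n = 0"
  "coord (x + y) n = coord x n + coord y n"
  "coord (x - y) n = coord x n - coord y n"
  "coord (- x) n = - coord x n"
  "coord (r *\<^sub>R x) n = complex_of_real r * coord x n"
  "coord (c *\<^sub>C x) n = c * coord x n"
  by (transfer; simp)+

lemma coord_sum [simp]: "coord (sum f A) n = (\<Sum>a\<in>A. coord (f a) n)"
  by (induction A rule: infinite_finite_induct) simp_all

text \<open>The inner product is linear in the second argument.\<close>

definition cinner :: "ell2 \<Rightarrow> ell2 \<Rightarrow> complex" where
  "cinner x y = (\<Sum>n. cnj (coord x n) * coord y n)"

lemma cinner_sums: "(\<lambda>n. cnj (coord x n) * coord y n) sums cinner x y"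
  unfolding cinner_def by (rule summable_sums[OF ell2_summable_cnj_mult])

lemma cinner_eqI: "(\<lambda>n. cnj (coord x n) * coord y n) sums c \<Longrightarrow> cinner x y = c"
  using cinner_sums sums_unique2 by blast

lemma cinner_add_left: "cinner (x + y) z = cinner x z + cinner y z"
  using sums_add[OF cinner_sums[of x z] cinner_sums[of y z]]
  by (intro cinner_eqI) (simp add: distrib_right)

lemma cinner_add_right: "cinner x (y + z) = cinner x y + cinner x z"
  using sums_add[OF cinner_sums[of x y] cinner_sums[of x z]]
  by (intro cinner_eqI) (simp add: distrib_left)

lemma cinner_scaleC_left: "cinner (c *\<^sub>C x) y = cnj c * cinner x y"
  using sums_mult[OF cinner_sums[of x y], of "cnj c"]
  by (intro cinner_eqI) (simp add: mult.assoc)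

lemma cinner_scaleC_right: "cinner x (c *\<^sub>C y) = c * cinner x y"
  using sums_mult[OF cinner_sums[of x y], of c]
  by (intro cinner_eqI) (simp add: mult.left_commute)

lemma cinner_commute: "cinner x y = cnj (cinner y x)"
proof (rule cinner_eqI)
  have "(\<lambda>n. cnj (cnj (coord y n) * coord x n)) sums cnj (cinner y x)"
    unfolding sums_cnj by (rule cinner_sums)
  then show "(\<lambda>n. cnj (coord x n) * coord y n) sums cnj (cinner y x)"
    by (simp add: mult.commute)
qed

lemma cinner_self: "cinner x x = complex_of_real (\<Sum>n. (cmod (coord x n))\<^sup>2)"
proof (rule cinner_eqI)
  have "(\<lambda>n. complex_of_real ((cmod (coord x n))\<^sup>2)) sums complex_of_real (\<Sum>n. (cmod (coord x n))\<^sup>2)"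
    by (intro sums_of_real summable_sums summable_coord)
  then show "(\<lambda>n. cnj (coord x n) * coord x n) sums complex_of_real (\<Sum>n. (cmod (coord x n))\<^sup>2)"
    by (simp only: complex_norm_square mult.commute)
qed

instantiation ell2 :: real_inner
begin

definition inner_ell2 :: "ell2 \<Rightarrow> ell2 \<Rightarrow> real" where
  "inner_ell2 x y = Re (cinner x y)"
definition norm_ell2 :: "ell2 \<Rightarrow> real" where
  "norm_ell2 x = sqrt (\<Sum>n. (cmod (coord x n))\<^sup>2)"
definition sgn_ell2 :: "ell2 \<Rightarrow> ell2" where
  "sgn_ell2 x = x /\<^sub>R norm x"
definition dist_ell2 :: "ell2 \<Rightarrow> ell2 \<Rightarrow> real" where
  "dist_ell2 x y = norm (x - y)"
definition uniformity_ell2 :: "(ell2 \<times> ell2) filter" where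
  "uniformity_ell2 = (INF e\<in>{0<..}. principal {(x, y). dist x y < e})"
definition open_ell2 :: "ell2 set \<Rightarrow> bool" where
  "open_ell2 U \<longleftrightarrow> (\<forall>x\<in>U. \<forall>\<^sub>F (x', y) in uniformity. x' = x \<longrightarrow> y \<in> U)"

instance
proof
  fix x y z :: ell2 and r :: real and U :: "ell2 set"
  show "dist x y = norm (x - y)" by (rule dist_ell2_def)
  show "sgn x = x /\<^sub>R norm x" by (rule sgn_ell2_def)
  show "uniformity = (INF e\<in>{0<..}. principal {(x, y :: ell2). dist x y < e})"
    by (rule uniformity_ell2_def)
  show "open U \<longleftrightarrow> (\<forall>x\<in>U. \<forall>\<^sub>F (x', y) in uniformity. x' = x \<longrightarrow> y \<in> U)"
    by (rule open_ell2_def)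
  show "inner x y = inner y x"
    unfolding inner_ell2_def by (subst cinner_commute) simp
  show "inner (x + y) z = inner x z + inner y z"
    by (simp add: inner_ell2_def cinner_add_left)
  have "r *\<^sub>R x = complex_of_real r *\<^sub>C x" by (rule ell2_eqI) simp
  then show "inner (r *\<^sub>R x) y = r * inner x y"
    by (simp add: inner_ell2_def cinner_scaleC_left)
  show "0 \<le> inner x x"
    by (simp add: inner_ell2_def cinner_self suminf_nonneg summable_coord)
  show "inner x x = 0 \<longleftrightarrow> x = 0"
    by (auto simp: inner_ell2_def cinner_self suminf_eq_zero_iff summable_coord intro: ell2_eqI)
  show "norm x = sqrt (inner x x)"
    by (simp add: inner_ell2_def cinner_self norm_ell2_def)
qed

end

lift_definition basis :: "nat \<Rightarrow> ell2" is "\<lambda>k n. if n = k then 1 else 0"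
proof -
  fix k :: nat
  have "(\<lambda>n. (cmod (if n = k then 1 else 0))\<^sup>2) = (\<lambda>n. if n = k then 1 else 0 :: real)" by auto
  then show "summable (\<lambda>n. (cmod (if n = k then 1 else 0))\<^sup>2)" by simp
qed

lemma coord_basis: "coord (basis k) n = (if n = k then 1 else 0)"
  by transfer simp

lemma cinner_basis: "cinner (basis k) x = coord x k"
proof -
  have "(\<lambda>n. cnj (coord (basis k) n) * coord x n) = (\<lambda>n. if n = k then coord x n else 0)"
    by (auto simp: coord_basis)
  then show ?thesis
    unfolding cinner_def using sums_single[of k "coord x"] by (simp add: sums_iff)
qed


section \<open>The algebra of bounded operators\<close>

text \<open>\<open>bounded_linear\<close> is real linearity, so complex homogeneity is required separately.\<close>

typedef ell2_op =
  "{f :: ell2 \<Rightarrow> ell2. bounded_linear f \<and> (\<forall>c x. f (c *\<^sub>C x) = c *\<^sub>C f x)}"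
  morphisms app Abs_ell2_op
  by (rule exI[of _ "\<lambda>x. x"]) (simp add: bounded_linear_ident)

setup_lifting type_definition_ell2_op

lemma ell2_op_eqI: "(\<And>x. app f x = app g x) \<Longrightarrow> f = g"
  by (simp add: app_inject[symmetric] fun_eq_iff)

lemma bounded_linear_app: "bounded_linear (app f)"
  using app[of f] by simp

lemma app_scaleC: "app f (c *\<^sub>C x) = c *\<^sub>C app f x"
  using app[of f] by simp

lemma app_add: "app f (x + y) = app f x + app f y"
  using bounded_linear_app linear_simps(1) by blast

lemma bounded_linear_scaleC: "bounded_linear (\<lambda>x :: ell2. c *\<^sub>C x)"
proof (rule bounded_linear_intro)
  show "norm (c *\<^sub>C x) \<le> norm x * cmod c" for x :: ell2
    by (simp add: norm_ell2_def norm_mult power_mult_distrib suminf_mult summable_coord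
        real_sqrt_mult mult.commute)
qed (auto intro: ell2_eqI simp: algebra_simps)

instantiation ell2_op :: ring_1
begin

lift_definition zero_ell2_op :: ell2_op is "\<lambda>_. 0" by (auto intro: ell2_eqI)
lift_definition one_ell2_op :: ell2_op is "\<lambda>x. x" by (simp add: bounded_linear_ident)
lift_definition plus_ell2_op :: "ell2_op \<Rightarrow> ell2_op \<Rightarrow> ell2_op" is "\<lambda>f g x. f x + g x"
  by (auto simp: bounded_linear_add scaleC_add_right)
lift_definition minus_ell2_op :: "ell2_op \<Rightarrow> ell2_op \<Rightarrow> ell2_op" is "\<lambda>f g x. f x - g x"
  by (auto simp: bounded_linear_sub intro: ell2_eqI simp: algebra_simps)
lift_definition uminus_ell2_op :: "ell2_op \<Rightarrow> ell2_op" is "\<lambda>f x. - f x"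
  by (auto simp: bounded_linear_minus intro: ell2_eqI)
lift_definition times_ell2_op :: "ell2_op \<Rightarrow> ell2_op \<Rightarrow> ell2_op" is "\<lambda>f g x. f (g x)"
  by (auto intro: bounded_linear_compose)

instance
proof
  fix f g h :: ell2_op
  show "f * g * h = f * (g * h)" by transfer simp
  show "f + g + h = f + (g + h)" by transfer (simp add: add.assoc)
  show "f + g = g + f" by transfer (simp add: add.commute)
  show "0 + f = f" by transfer simp
  show "- f + f = 0" by transfer simp
  show "f - g = f + - g" by transfer simp
  show "1 * f = f" by transfer simp
  show "f * 1 = f" by transfer simp
  show "(f + g) * h = f * h + g * h" by transfer simp
  show "f * (g + h) = f * g + f * h" by transfer (auto simp: linear_simps)
  have "app 0 (basis 0) \<noteq> app 1 (basis 0)"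
  proof
    assume "app 0 (basis 0) = app 1 (basis 0)"
    then have "coord (app 0 (basis 0)) 0 = coord (app 1 (basis 0)) 0" by simp
    then show False by (simp add: zero_ell2_op.rep_eq one_ell2_op.rep_eq coord_basis)
  qed
  then show "(0::ell2_op) \<noteq> 1" by metis
qed

end

instantiation ell2_op :: complex_vector
begin

lift_definition scaleC_ell2_op :: "complex \<Rightarrow> ell2_op \<Rightarrow> ell2_op" is "\<lambda>c f x. c *\<^sub>C f x"
  by (auto simp: bounded_linear_scaleC[THEN bounded_linear_compose] scaleC_scaleC mult.commute)

instance
  by standard
    (transfer; simp add: fun_eq_iff scaleC_add_right scaleC_add_left scaleC_scaleC scaleC_one)+

end

lemma app_simps [simp]:
  "app 0 x = 0"
  "app 1 x = x"
  "app (f + g) x = app f x + app g x"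
  "app (f - g) x = app f x - app g x"
  "app (- f) x = - app f x"
  "app (f * g) x = app f (app g x)"
  "app (c *\<^sub>C f) x = c *\<^sub>C app f x"
  by (transfer; simp)+

definition adj :: "ell2_op \<Rightarrow> ell2_op" where
  "adj f = (THE g. \<forall>x y. cinner (app g x) y = cinner x (app f y))"

lemma adj_unique:
  assumes "\<And>x y. cinner (app g x) y = cinner x (app f y)"
  shows "adj f = g"
  unfolding adj_def
proof (rule the_equality)
  show "\<forall>x y. cinner (app g x) y = cinner x (app f y)" using assms by blast
  fix h assume h: "\<forall>x y. cinner (app h x) y = cinner x (app f y)"
  show "h = g"
  proof (intro ell2_op_eqI ell2_eqI)
    fix x n
    have "cinner (app h x) (basis n) = cinner (app g x) (basis n)" using h assms by simp
    then show "coord (app h x) n = coord (app g x) n"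
      by (metis cinner_basis cinner_commute)
  qed
qed

text \<open>Every bounded operator has an adjoint (\<open>adjoint_exists\<close> below), so the definite description
  in \<open>adj\<close> always denotes.\<close>

lemma ell2_expansion: "(\<lambda>n. coord y n *\<^sub>C basis n) sums y"
proof -
  let ?c = "\<lambda>n. (cmod (coord y n))\<^sup>2"
  have part: "coord (\<Sum>k<N. coord y k *\<^sub>C basis k) n = (if n < N then coord y n else 0)" for N n
    by (simp add: coord_basis if_distrib[where f = "\<lambda>x. _ * x"] cong: if_cong)
  have eq: "norm ((\<Sum>k<N. coord y k *\<^sub>C basis k) - y) = sqrt (suminf ?c - sum ?c {..<N})" for N
  proof -
    have "(\<Sum>n. (cmod (coord ((\<Sum>k<N. coord y k *\<^sub>C basis k) - y) n))\<^sup>2)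
        = (\<Sum>n. if n < N then 0 else ?c n)"
      by (intro suminf_cong) (simp only: coord_simps part, simp)
    also have "\<dots> = (\<Sum>n. ?c n - (if n \<in> {..<N} then ?c n else 0))"
      by (intro suminf_cong) simp
    also have "\<dots> = suminf ?c - sum ?c {..<N}"
      using sums_diff[OF summable_sums[OF summable_coord[of y]] sums_If_finite_set[of "{..<N}" ?c]]
      by (simp add: sums_iff)
    finally show ?thesis by (simp add: norm_ell2_def)
  qed
  have "(\<lambda>N. sqrt (suminf ?c - sum ?c {..<N})) \<longlonglongrightarrow> sqrt (suminf ?c - suminf ?c)"
    by (intro tendsto_intros summable_LIMSEQ summable_coord)
  then have "(\<lambda>N. norm ((\<Sum>k<N. coord y k *\<^sub>C basis k) - y)) \<longlonglongrightarrow> 0"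
    by (simp only: eq) simp
  then show ?thesis
    unfolding sums_def by (subst LIM_zero_iff[symmetric]) (simp add: tendsto_norm_zero_iff)
qed

lemma cinner_norm: "cinner x x = complex_of_real ((norm x)\<^sup>2)"
  by (simp add: cinner_self norm_ell2_def suminf_nonneg summable_coord)

lemma cinner_sum_left: "cinner (sum f A) y = (\<Sum>a\<in>A. cinner (f a) y)"
proof -
  have "cinner 0 y = 0" by (simp add: cinner_def)
  then show ?thesis
    by (induction A rule: infinite_finite_induct) (simp_all add: cinner_add_left)
qed

lemma bounded_linear_cinner_right: "bounded_linear (cinner x)"
proof (rule bounded_linear_intro)
  fix y z :: ell2 and r :: real
  show "cinner x (y + z) = cinner x y + cinner x z" by (rule cinner_add_right)
  have "r *\<^sub>R y = complex_of_real r *\<^sub>C y" by (rule ell2_eqI) simp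
  then show "cinner x (r *\<^sub>R y) = r *\<^sub>R cinner x y"
    by (simp add: cinner_scaleC_right scaleR_conv_of_real)
  define c where "c = cinner x y"
  have re: "Re (cinner x v) \<le> norm x * norm v" for v
    using norm_cauchy_schwarz[of x v] by (simp add: inner_ell2_def)
  have "cinner x (cnj c *\<^sub>C y) = complex_of_real ((cmod c)\<^sup>2)"
    using complex_norm_square[of c] by (simp add: cinner_scaleC_right c_def mult.commute)
  then have "(cmod c)\<^sup>2 \<le> norm x * norm (cnj c *\<^sub>C y)"
    using re[of "cnj c *\<^sub>C y"] by simp
  also have "norm (cnj c *\<^sub>C y) = cmod c * norm y"
    by (simp add: norm_ell2_def norm_mult power_mult_distrib suminf_mult summable_coord
        real_sqrt_mult)
  finally have "cmod c * cmod c \<le> cmod c * (norm y * norm x)"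
    by (simp add: power2_eq_square algebra_simps)
  then have "cmod c \<le> norm y * norm x"
    by (cases "cmod c = 0") auto
  then show "norm (cinner x y) \<le> norm y * norm x" unfolding c_def .
qed

lemma adjoint_exists: "\<exists>g. \<forall>x y. cinner (app g x) y = cinner x (app f y)"
proof -
  obtain K where K: "\<And>x. norm (app f x) \<le> norm x * K" and "K > 0"
    using bounded_linear.pos_bounded[OF bounded_linear_app] by blast
  define c where "c x n = cinner (app f (basis n)) x" for x n
  have partial: "(\<Sum>n<N. (cmod (c x n))\<^sup>2) \<le> (K * norm x)\<^sup>2" for x N
  proof -
    define S where "S = (\<Sum>n<N. (cmod (c x n))\<^sup>2)"
    define v where "v = (\<Sum>n<N. c x n *\<^sub>C basis n)"
    have coord_v: "coord v n = (if n \<in> {..<N} then c x n else 0)" for n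
      unfolding v_def
      by (simp add: coord_basis if_distrib[where f = "\<lambda>x. _ * x"] cong: if_cong)
    have "(\<Sum>n. (cmod (coord v n))\<^sup>2) = (\<Sum>n. if n \<in> {..<N} then (cmod (c x n))\<^sup>2 else 0)"
      by (intro suminf_cong) (simp add: coord_v)
    also have "\<dots> = S"
      unfolding S_def using sums_If_finite_set[of "{..<N}" "\<lambda>n. (cmod (c x n))\<^sup>2"]
      by (simp add: sums_iff)
    finally have norm_v: "norm v = sqrt S" by (simp add: norm_ell2_def)
    have "S \<ge> 0" unfolding S_def by (intro sum_nonneg) simp
    have "app f v = (\<Sum>n<N. c x n *\<^sub>C app f (basis n))"
      unfolding v_def
      by (simp add: linear_sum[OF bounded_linear.linear[OF bounded_linear_app]] app_scaleC)
    then have "cinner (app f v) x = (\<Sum>n<N. cnj (c x n) * c x n)"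
      by (simp add: cinner_sum_left cinner_scaleC_left c_def)
    also have "\<dots> = complex_of_real S"
      by (simp only: S_def of_real_sum complex_norm_square mult.commute)
    finally have "S = inner (app f v) x" by (simp add: inner_ell2_def)
    also have "\<dots> \<le> norm (app f v) * norm x" by (rule norm_cauchy_schwarz)
    also have "\<dots> \<le> sqrt S * K * norm x"
      using K[of v] norm_v by (intro mult_right_mono) auto
    finally have *: "sqrt S * sqrt S \<le> sqrt S * (K * norm x)"
      using \<open>S \<ge> 0\<close> by (simp add: mult.assoc)
    have "sqrt S \<le> K * norm x"
    proof (cases "S = 0")
      case False
      then have "sqrt S > 0" using \<open>S \<ge> 0\<close> by simp
      then show ?thesis using * mult_le_cancel_left_pos by blast
    qed (use \<open>K > 0\<close> in simp)
    then have "(sqrt S)\<^sup>2 \<le> (K * norm x)\<^sup>2"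
      using \<open>S \<ge> 0\<close> by (intro power_mono) auto
    then show ?thesis using \<open>S \<ge> 0\<close> by (simp add: S_def)
  qed
  have summ: "summable (\<lambda>n. (cmod (c x n))\<^sup>2)" for x
    by (rule bounded_imp_summable[where B = "(K * norm x)\<^sup>2"])
      (use partial[of x] in \<open>auto simp: lessThan_Suc_atMost[symmetric] simp del: sum.lessThan_Suc\<close>)
  define g where "g x = Abs_ell2 (c x)" for x
  have coord_g: "coord (g x) n = c x n" for x n
    unfolding g_def using summ by (simp add: Abs_ell2_inverse)
  have "bounded_linear g"
  proof (rule bounded_linear_intro)
    fix x y :: ell2 and r :: real
    show "g (x + y) = g x + g y"
      by (rule ell2_eqI) (simp add: coord_g c_def cinner_add_right)
    show "g (r *\<^sub>R x) = r *\<^sub>R g x"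
      by (rule ell2_eqI)
        (simp add: coord_g c_def linear_simps(5)[OF bounded_linear_cinner_right] scaleR_conv_of_real)
    have "(\<Sum>n. (cmod (c x n))\<^sup>2) \<le> (K * norm x)\<^sup>2"
      by (rule suminf_le_const[OF summ partial])
    then have "sqrt (\<Sum>n. (cmod (c x n))\<^sup>2) \<le> K * norm x"
      using \<open>K > 0\<close> by (intro real_le_lsqrt) auto
    then show "norm (g x) \<le> norm x * K"
      by (simp add: norm_ell2_def coord_g mult.commute)
  qed
  moreover have "g (d *\<^sub>C x) = d *\<^sub>C g x" for d x
    by (rule ell2_eqI) (simp add: coord_g c_def cinner_scaleC_right)
  ultimately have app_g: "app (Abs_ell2_op g) = g"
    by (simp add: Abs_ell2_op_inverse)
  have "cinner (g x) y = cinner x (app f y)" for x y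
  proof -
    have "(\<lambda>n. cinner x (app f (coord y n *\<^sub>C basis n))) sums cinner x (app f y)"
      by (intro bounded_linear.sums[OF bounded_linear_cinner_right]
          bounded_linear.sums[OF bounded_linear_app] ell2_expansion)
    moreover have "cinner x (app f (coord y n *\<^sub>C basis n)) = cnj (coord (g x) n) * coord y n" for n
      by (simp add: app_scaleC cinner_scaleC_right coord_g c_def mult.commute
          cinner_commute[of x "app f (basis n)"])
    ultimately show ?thesis
      unfolding cinner_def[of "g x" y] by (simp add: sums_iff)
  qed
  then show ?thesis
    by (intro exI[of _ "Abs_ell2_op g"]) (simp add: app_g)
qed

lemma cinner_adj: "cinner (app (adj f) x) y = cinner x (app f y)"
  using adjoint_exists[of f] adj_unique by metis

text \<open>
  The diagonal operator \<open>e\<^sub>n \<mapsto> d n e\<^sub>n\<close> is bounded exactly when the sequence \<open>d\<close> is;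
  otherwise \<open>diag_op d\<close> has the dummy value 0.
\<close>

lift_definition ell2_mult :: "(nat \<Rightarrow> complex) \<Rightarrow> ell2 \<Rightarrow> ell2" is
  "\<lambda>d x n. if bounded (range d) then d n * x n else 0"
proof -
  fix d x :: "nat \<Rightarrow> complex"
  assume x: "summable (\<lambda>n. (cmod (x n))\<^sup>2)"
  show "summable (\<lambda>n. (cmod (if bounded (range d) then d n * x n else 0))\<^sup>2)"
  proof (cases "bounded (range d)")
    case True
    then obtain K where K: "\<And>n. cmod (d n) \<le> K" by (auto simp: bounded_iff)
    have "summable (\<lambda>n. (cmod (d n * x n))\<^sup>2)"
    proof (rule summable_comparison_test')
      show "summable (\<lambda>n. K\<^sup>2 * (cmod (x n))\<^sup>2)" by (intro summable_mult x)
      show "norm ((cmod (d n * x n))\<^sup>2) \<le> K\<^sup>2 * (cmod (x n))\<^sup>2" for n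
        using K[of n] by (auto simp: norm_mult power_mult_distrib intro!: mult_right_mono power_mono)
    qed
    then show ?thesis using True by simp
  qed simp
qed

lift_definition diag_op :: "(nat \<Rightarrow> complex) \<Rightarrow> ell2_op" is ell2_mult
proof
  fix d :: "nat \<Rightarrow> complex"
  show "bounded_linear (ell2_mult d)"
  proof (cases "bounded (range d)")
    case True
    then obtain K where K: "\<And>n. cmod (d n) \<le> K" by (auto simp: bounded_iff)
    have K0: "K \<ge> 0" using K[of 0] norm_ge_zero order_trans by blast
    show ?thesis
    proof (rule bounded_linear_intro)
      fix x y :: ell2 and r :: real
      show "ell2_mult d (x + y) = ell2_mult d x + ell2_mult d y"
        by (rule ell2_eqI) (simp add: ell2_mult.rep_eq algebra_simps)
      show "ell2_mult d (r *\<^sub>R x) = r *\<^sub>R ell2_mult d x"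
        by (rule ell2_eqI) (simp add: ell2_mult.rep_eq)
      have "(\<Sum>n. (cmod (coord (ell2_mult d x) n))\<^sup>2) \<le> (\<Sum>n. K\<^sup>2 * (cmod (coord x n))\<^sup>2)"
        using K True by (intro suminf_le summable_mult summable_coord)
          (auto simp: ell2_mult.rep_eq norm_mult power_mult_distrib intro!: mult_right_mono power_mono)
      also have "\<dots> = K\<^sup>2 * (\<Sum>n. (cmod (coord x n))\<^sup>2)"
        by (rule suminf_mult[OF summable_coord])
      finally have "sqrt (\<Sum>n. (cmod (coord (ell2_mult d x) n))\<^sup>2)
          \<le> sqrt (K\<^sup>2 * (\<Sum>n. (cmod (coord x n))\<^sup>2))" by simp
      then show "norm (ell2_mult d x) \<le> norm x * K"
        using K0 by (simp add: norm_ell2_def real_sqrt_mult mult.commute)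
    qed
  next
    case False
    then have "ell2_mult d = (\<lambda>_. 0)"
      by (auto simp: ell2_mult.rep_eq intro!: ell2_eqI)
    then show ?thesis by simp
  qed
  show "\<forall>c x. ell2_mult d (c *\<^sub>C x) = c *\<^sub>C ell2_mult d x"
    by (auto intro!: ell2_eqI simp: ell2_mult.rep_eq)
qed

lemma diag_op_basis:
  assumes "bounded (range d)"
  shows "app (diag_op d) (basis n) = d n *\<^sub>C basis n"
  using assms by (intro ell2_eqI) (simp add: diag_op.rep_eq ell2_mult.rep_eq coord_basis)

lift_definition ell2_shift :: "ell2 \<Rightarrow> ell2" is "\<lambda>x n. case n of 0 \<Rightarrow> 0 | Suc m \<Rightarrow> x m"
proof -
  fix x :: "nat \<Rightarrow> complex"
  assume "summable (\<lambda>n. (cmod (x n))\<^sup>2)"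
  then show "summable (\<lambda>n. (cmod (case n of 0 \<Rightarrow> 0 | Suc m \<Rightarrow> x m))\<^sup>2)"
    by (subst summable_Suc_iff[symmetric]) simp
qed

lemma norm_ell2_shift: "norm (ell2_shift x) = norm x"
proof -
  have "(\<lambda>n. (cmod (coord (ell2_shift x) (Suc n)))\<^sup>2) sums (\<Sum>n. (cmod (coord x n))\<^sup>2)"
    using summable_sums[OF summable_coord[of x]] by (simp add: ell2_shift.rep_eq)
  then have "(\<lambda>n. (cmod (coord (ell2_shift x) n))\<^sup>2) sums (\<Sum>n. (cmod (coord x n))\<^sup>2)"
    by (subst (asm) sums_Suc_iff) (simp add: ell2_shift.rep_eq)
  then show ?thesis by (simp add: norm_ell2_def sums_iff)
qed

lift_definition shift :: ell2_op is ell2_shift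
proof
  show "bounded_linear ell2_shift"
    by (rule bounded_linear_intro[where K = 1])
      (auto simp: norm_ell2_shift ell2_shift.rep_eq intro!: ell2_eqI split: nat.split)
  show "\<forall>c x. ell2_shift (c *\<^sub>C x) = c *\<^sub>C ell2_shift x"
    by (auto simp: ell2_shift.rep_eq intro!: ell2_eqI split: nat.split)
qed

lemma shift_basis: "app shift (basis n) = basis (Suc n)"
  by (intro ell2_eqI) (auto simp: shift.rep_eq ell2_shift.rep_eq coord_basis split: nat.split)


section \<open>Transition operators\<close>

text \<open>
  Operators on \<open>\<H> \<otimes> \<complex>\<^sup>2\<close> are \<open>2 \<times> 2\<close> matrices with entries in \<open>\<B>(\<H>)\<close>; their product is
  the library's matrix product. The rows and columns of a matrix of type \<open>'a^2^2\<close> are indexed by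
  \<open>1\<close> and \<open>2\<close>.
\<close>

definition tensor :: "ell2_op \<Rightarrow> complex^2^2 \<Rightarrow> ell2_op^2^2" (infixr "\<otimes>" 70) where
  "x \<otimes> y = (\<chi> i j. (y $ i $ j) *\<^sub>C x)"

definition mat_adj :: "ell2_op^2^2 \<Rightarrow> ell2_op^2^2" where
  "mat_adj X = (\<chi> i j. adj (X $ j $ i))"

definition mat_unit :: "2 \<Rightarrow> 2 \<Rightarrow> complex^2^2" where
  "mat_unit k l = (\<chi> i j. if i = k \<and> j = l then 1 else 0)"

definition slice :: "(complex^2^2 \<Rightarrow> complex) \<Rightarrow> ell2_op^2^2 \<Rightarrow> ell2_op" where
  "slice \<psi> X = (\<Sum>i\<in>UNIV. \<Sum>j\<in>UNIV. \<psi> (mat_unit i j) *\<^sub>C X $ i $ j)"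

text \<open>For a linear functional \<open>\<psi>\<close>, \<open>slice \<psi>\<close> is the unique additive map with
  \<open>x \<otimes> y \<mapsto> \<psi>(y) x\<close>.\<close>

lemma matrix_decomp: "X = (\<Sum>i\<in>UNIV. \<Sum>j\<in>UNIV. X $ i $ j \<otimes> mat_unit i j)"
proof -
  have "(1::2) \<noteq> 2" "(2::2) \<noteq> 1" by simp_all
  then show ?thesis
    by (simp add: vec_eq_iff forall_2 sum_2 tensor_def mat_unit_def scaleC_one)
qed

lemma slice_tensor:
  assumes "\<And>y z. \<psi> (y + z) = \<psi> y + \<psi> z" and "\<And>c y. \<psi> (\<chi> i j. c * y $ i $ j) = c * \<psi> y"
  shows "slice \<psi> (x \<otimes> y) = \<psi> y *\<^sub>C x"
proof -
  have "(1::2) \<noteq> 2" "(2::2) \<noteq> 1" by simp_all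
  then have y: "y = ((\<chi> i j. y $ 1 $ 1 * mat_unit 1 1 $ i $ j) + (\<chi> i j. y $ 1 $ 2 * mat_unit 1 2 $ i $ j))
      + ((\<chi> i j. y $ 2 $ 1 * mat_unit 2 1 $ i $ j) + (\<chi> i j. y $ 2 $ 2 * mat_unit 2 2 $ i $ j))"
    by (simp add: vec_eq_iff forall_2 mat_unit_def)
  have "\<psi> y = (y $ 1 $ 1 * \<psi> (mat_unit 1 1) + y $ 1 $ 2 * \<psi> (mat_unit 1 2))
      + (y $ 2 $ 1 * \<psi> (mat_unit 2 1) + y $ 2 $ 2 * \<psi> (mat_unit 2 2))"
    by (subst y) (simp only: assms)
  then show ?thesis
    by (simp add: slice_def tensor_def sum_2 scaleC_scaleC scaleC_add_left mult.commute)
qed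

lemma slice_unique:
  assumes "\<And>X Y. P (X + Y) = P X + P Y" and "\<And>x y. P (x \<otimes> y) = \<psi> y *\<^sub>C x"
  shows "P X = slice \<psi> X"
  by (subst matrix_decomp[of X]) (simp add: sum_2 slice_def assms)

definition coupling :: "(nat \<Rightarrow> real) \<Rightarrow> (nat \<Rightarrow> real) \<Rightarrow> ell2_op^2^2" where
  "coupling \<alpha> \<beta> =
    (let a = diag_op (\<lambda>n. complex_of_real (\<alpha> n));
         b = diag_op (\<lambda>n. complex_of_real (\<beta> n));
         s = shift
     in vector [vector [adj s * a * s, \<i> *\<^sub>C (adj s * b)],
                vector [\<i> *\<^sub>C (b * s), a]])"

definition transition_op ::
  "ell2_op^2^2 \<Rightarrow> (complex^2^2 \<Rightarrow> complex) \<Rightarrow> ell2_op \<Rightarrow> ell2_op" where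
  "transition_op u \<psi> x = slice \<psi> (mat_adj u ** (x \<otimes> mat 1) ** u)"

definition diag_state :: "real \<Rightarrow> complex^2^2 \<Rightarrow> complex" where
  "diag_state r y = complex_of_real r * y $ 1 $ 1 + complex_of_real (1 - r) * y $ 2 $ 2"

lemma slice_diag_state: "slice (diag_state r) (x \<otimes> y) = diag_state r y *\<^sub>C x"
  by (rule slice_tensor) (simp_all add: diag_state_def algebra_simps)

definition fixed_space :: "(ell2_op \<Rightarrow> ell2_op) \<Rightarrow> ell2_op set" where
  "fixed_space T = {x. T x = x}"

definition ergodic :: "(ell2_op \<Rightarrow> ell2_op) \<Rightarrow> bool" where
  "ergodic T \<longleftrightarrow> fixed_space T = range (\<lambda>c. c *\<^sub>C 1)"

definition weakly_mixing :: "(ell2_op \<Rightarrow> ell2_op) \<Rightarrow> bool" where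
  "weakly_mixing T \<longleftrightarrow>
    (\<forall>x \<mu>. cmod \<mu> = 1 \<and> T x = \<mu> *\<^sub>C x \<longrightarrow> x \<in> range (\<lambda>c. c *\<^sub>C 1))"


section \<open>Unitarity of the coupling\<close>

lemma adj_times: "adj (f * g) = adj g * adj f"
  by (rule adj_unique) (simp add: cinner_adj)

lemma adj_scaleC: "adj (c *\<^sub>C f) = cnj c *\<^sub>C adj f"
  by (rule adj_unique) (simp add: cinner_adj cinner_scaleC_left cinner_scaleC_right)

lemma adj_adj: "adj (adj f) = f"
  by (rule adj_unique) (metis cinner_adj cinner_commute)

lemma coord_diag_op:
  "bounded (range d) \<Longrightarrow> coord (app (diag_op d) x) n = d n * coord x n"
  by (simp add: diag_op.rep_eq ell2_mult.rep_eq)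

lemma adj_diag_op:
  assumes "bounded (range (\<lambda>n. complex_of_real (d n)))"
  shows "adj (diag_op (\<lambda>n. complex_of_real (d n))) = diag_op (\<lambda>n. complex_of_real (d n))"
  by (rule adj_unique) (simp add: cinner_def coord_diag_op assms mult.left_commute mult.assoc)

lemma coord_shift: "coord (app shift x) n = (case n of 0 \<Rightarrow> 0 | Suc m \<Rightarrow> coord x m)"
  by (simp add: shift.rep_eq ell2_shift.rep_eq)

lemma coord_adj_shift: "coord (app (adj shift) x) n = coord x (Suc n)"
proof -
  have "cinner x (app shift (basis n)) = cinner (app (adj shift) x) (basis n)"
    by (simp add: cinner_adj)
  then show ?thesis
    by (metis shift_basis cinner_basis cinner_commute)
qed

lemma coupling_unitary:
  assumes "\<alpha> 0 = 1" "\<beta> 0 = 0" "\<And>n. (\<alpha> n)\<^sup>2 + (\<beta> n)\<^sup>2 = 1"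
  shows "mat_adj (coupling \<alpha> \<beta>) ** coupling \<alpha> \<beta> = mat 1"
    and "coupling \<alpha> \<beta> ** mat_adj (coupling \<alpha> \<beta>) = mat 1"
proof -
  have "\<bar>\<alpha> n\<bar> \<le> 1" "\<bar>\<beta> n\<bar> \<le> 1" for n
    using assms(3)[of n] zero_le_power2[of "\<alpha> n"] zero_le_power2[of "\<beta> n"]
    by (simp_all only: abs_square_le_1[symmetric])
  then have bd: "bounded (range (\<lambda>n. complex_of_real (\<alpha> n)))"
    "bounded (range (\<lambda>n. complex_of_real (\<beta> n)))"
    by (auto simp: bounded_iff)
  have sq: "complex_of_real (\<alpha> n) * (complex_of_real (\<alpha> n) * z) + complex_of_real (\<beta> n) * (complex_of_real (\<beta> n) * z) = z" for n z
    using arg_cong[OF assms(3)[of n], of "\<lambda>t. complex_of_real t * z"]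
    by (simp add: power2_eq_square algebra_simps)
  show "mat_adj (coupling \<alpha> \<beta>) ** coupling \<alpha> \<beta> = mat 1"
    "coupling \<alpha> \<beta> ** mat_adj (coupling \<alpha> \<beta>) = mat 1"
    unfolding coupling_def mat_adj_def matrix_matrix_mult_def mat_def vec_eq_iff Let_def
    by (auto simp: forall_2 sum_2 adj_times adj_scaleC adj_adj adj_diag_op bd coord_diag_op
        coord_shift coord_adj_shift sq assms(1,2) app_scaleC add.commute
        intro!: ell2_op_eqI ell2_eqI split: nat.split)
qed

end

theory Submission
  imports Defs
begin

text \<open>
  Write \<open>x\<^bsub>i,j\<^esub>\<close> for the matrix entries of an operator. The shift moves along diagonals, so the
  transition operator only mixes entries with the same \<open>j - i\<close>; this is \<open>entry_transition_op\<close>. On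
  each diagonal, read as a sequence \<open>y\<^sub>0, y\<^sub>1, \<dots>\<close>, it is the averaging operator of a lazy
  nearest-neighbour walk on \<open>\<nat>\<close>: stay with weight \<open>\<alpha>\<^sup>2\<close>, and otherwise step up with weight \<open>lam\<close> and
  down with weight \<open>1 - lam\<close>. The diagonals differ only in what happens at \<open>0\<close>: there the weight
  \<open>1 - lam\<close> is not used for idling or stepping down; instead \<open>y\<^sub>0\<close> itself enters with
  \<open>1 - lam\<close> times a factor \<open>g\<close>. On the main diagonal \<open>g = 1\<close> and the walk is reflected; on all others
  \<open>g = \<alpha>\<close>, and since \<open>\<bar>\<alpha>\<bar> < 1\<close>, mass is lost.

  For \<open>lam \<le> 1/2\<close> the walk is recurrent. A bounded eigensequence for an eigenvalue of modulus \<open>1\<close>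
  then has decreasing modulus, because an increase would propagate outwards without shrinking
  (\<open>bounded_eigensequence_antimono\<close>). The equation at \<open>0\<close> is a strict contraction off the main
  diagonal, and also on it if the eigenvalue is not \<open>1\<close>, so it forces \<open>y\<^sub>0 = 0\<close> and hence
  \<open>y = 0\<close>. What remains is the main diagonal with eigenvalue \<open>1\<close>; there
  subtracting the constant \<open>y\<^sub>0\<close> gives \<open>0\<close>, so the eigenoperator is a scalar.

  For \<open>lam > 1/2\<close> the walk drifts to infinity and escapes the loss of mass at \<open>0\<close> with positive
  probability. Accordingly there is a nonzero bounded harmonic sequence (\<open>walk_harmonic\<close>), the same
  for all off-diagonals. Placing it on the successive superdiagonals gives infinitely many linearly
  independent fixed points.
\<close>

section \<open>Matrix entries of operators\<close>

definition entry :: "ell2_op \<Rightarrow> nat \<Rightarrow> nat \<Rightarrow> complex" where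
  "entry x i j = coord (app x (basis j)) i"

lemma ell2_op_eqI_entry:
  assumes "\<And>i j. entry x i j = entry y i j"
  shows "x = y"
proof (rule ell2_op_eqI)
  fix v
  have basis: "app x (basis n) = app y (basis n)" for n
    using assms by (intro ell2_eqI) (simp add: entry_def)
  have "(\<lambda>n. app f (coord v n *\<^sub>C basis n)) sums app f v" for f
    by (intro bounded_linear.sums[OF bounded_linear_app] ell2_expansion)
  from this[of x] this[of y] show "app x v = app y v"
    by (simp add: app_scaleC basis sums_unique2)
qed

lemma entry_linear [simp]:
  "entry 0 i j = 0"
  "entry (x + y) i j = entry x i j + entry y i j"
  "entry (c *\<^sub>C x) i j = c * entry x i j"
  by (simp_all add: entry_def)

lemma entry_one: "entry 1 i j = (if i = j then 1 else 0)"
  by (simp add: entry_def coord_basis)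

lemma norm_basis: "norm (basis n) = 1"
proof -
  have "cinner (basis n) (basis n) = 1" by (simp add: cinner_basis coord_basis)
  then show ?thesis by (simp add: norm_eq_sqrt_inner inner_ell2_def)
qed

lemma cmod_coord_le_norm: "cmod (coord v n) \<le> norm v"
proof -
  have "(cmod (coord v n))\<^sup>2 \<le> (\<Sum>n. (cmod (coord v n))\<^sup>2)"
    using sum_le_suminf[OF summable_coord, of "{n}" v] by simp
  then show ?thesis
    unfolding norm_ell2_def by (rule real_le_rsqrt)
qed

lemma entry_bounded:
  obtains K where "\<And>i j. cmod (entry x i j) \<le> K"
proof -
  obtain K where K: "\<And>v. norm (app x v) \<le> norm v * K"
    using bounded_linear.bounded[OF bounded_linear_app] by blast
  have "cmod (entry x i j) \<le> K" for i j
    using order_trans[OF cmod_coord_le_norm K, of "basis j" i] by (simp add: entry_def norm_basis)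
  then show thesis by (rule that)
qed

section \<open>The transition operator on matrix entries\<close>

text \<open>
  A diagonal state sees only the diagonal blocks, that is, the sandwiches of \<open>x\<close> by the
  entries of one column of \<open>u\<close>.
\<close>

lemma transition_op_kraus:
  "transition_op u (diag_state r) x =
    complex_of_real r *\<^sub>C (adj (u$1$1) * x * u$1$1 + adj (u$2$1) * x * u$2$1)
    + complex_of_real (1 - r) *\<^sub>C (adj (u$1$2) * x * u$1$2 + adj (u$2$2) * x * u$2$2)"
proof -
  have ne: "(1::2) \<noteq> 2" "(2::2) \<noteq> 1" by simp_all
  have z: "(0::complex) *\<^sub>C y = 0" "(1::complex) *\<^sub>C y = y" for y :: ell2_op
    by (rule complex_vector.scale_zero_left, rule scaleC_one)
  show ?thesis
    by (simp add: transition_op_def slice_def diag_state_def mat_unit_def mat_adj_def tensor_def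
        matrix_matrix_mult_def mat_def sum_2 ne z)
qed

lemma app_adj_shift_basis:
  "app (adj shift) (basis j) = (if j = 0 then 0 else basis (j - 1))"
  by (rule ell2_eqI) (auto simp: coord_adj_shift coord_basis)

lemma app_zero: "app x 0 = 0"
  using bounded_linear.linear[OF bounded_linear_app] by (rule linear_0)

text \<open>The imaginary units in the off-diagonal blocks of the coupling cancel.\<close>

lemma sandwich_imaginary_unit: "adj (\<i> *\<^sub>C f) * x * (\<i> *\<^sub>C g) = adj f * x * g"
  by (rule ell2_op_eqI) (simp add: adj_scaleC app_scaleC scaleC_scaleC scaleC_one)

text \<open>
  Each of the four sandwiches preserves the diagonals. Up to rescaling, \<open>a\<close> and \<open>s\<^sup>* a s\<close> leave the entries in place,
  \<open>b s\<close> pulls them back by one step along the diagonal and \<open>s\<^sup>* b\<close> pushes them forward,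
  filling the first row and column with zeros.
\<close>

lemma entry_transition_op:
  assumes "bounded (range (\<lambda>n. complex_of_real (\<alpha> n)))"
    and "bounded (range (\<lambda>n. complex_of_real (\<beta> n)))"
  shows "entry (transition_op (coupling \<alpha> \<beta>) (diag_state r) x) i j =
    r * (\<alpha> (Suc i) * \<alpha> (Suc j) * entry x i j + \<beta> (Suc i) * \<beta> (Suc j) * entry x (Suc i) (Suc j))
    + (1 - r) * ((if i = 0 \<or> j = 0 then 0 else \<beta> i * \<beta> j * entry x (i - 1) (j - 1))
                 + \<alpha> i * \<alpha> j * entry x i j)"
  unfolding transition_op_kraus coupling_def Let_def vector_2 sandwich_imaginary_unit
  by (cases i; cases j)
    (simp_all add: entry_def adj_times adj_adj adj_diag_op assms coord_diag_op
      coord_shift coord_adj_shift app_scaleC app_zero shift_basis diag_op_basis app_adj_shift_basis mult_ac)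

section \<open>Bounded eigensequences\<close>

text \<open>
  Since \<open>\<bar>\<mu> - t\<bar> \<ge> 1 - t\<close>, the moduli are subharmonic for the walk that steps up with probability
  \<open>r\<close> and down with probability \<open>1 - r\<close>. Their increments \<open>d\<close> therefore satisfy
  \<open>r d\<^bsub>m+1\<^esub> \<ge> (1 - r) d\<^sub>m\<close>, so for \<open>r \<le> 1/2\<close> a positive increment is followed by increments at
  least as large, which contradicts boundedness.
\<close>

lemma bounded_eigensequence_antimono:
  fixes y :: "nat \<Rightarrow> complex" and t r :: real
  assumes "0 \<le> t" "t < 1" "0 \<le> r" "r \<le> 1/2" "cmod \<mu> = 1"
    and rec: "\<And>n. \<mu> * y (Suc n) = t * y (Suc n) + (1 - t) * (r * y (Suc (Suc n)) + (1 - r) * y n)"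
    and bdd: "\<And>n. cmod (y n) \<le> K"
  shows "cmod (y (Suc n)) \<le> cmod (y n)"
proof (rule ccontr)
  define d where "d n = cmod (y (Suc n)) - cmod (y n)" for n
  assume "\<not> ?thesis"
  then have pos: "d n > 0" by (simp add: d_def)
  have step: "(1 - r) * d m \<le> r * d (Suc m)" for m
  proof -
    have "1 - t \<le> cmod (\<mu> - t)"
      using norm_triangle_ineq2[of \<mu> "complex_of_real t"] assms by simp
    then have "(1 - t) * cmod (y (Suc m)) \<le> cmod (\<mu> - t) * cmod (y (Suc m))"
      by (rule mult_right_mono) simp
    also have "\<dots> = cmod ((\<mu> - t) * y (Suc m))"
      by (simp add: norm_mult)
    also have "(\<mu> - t) * y (Suc m)
        = of_real (1 - t) * (of_real r * y (Suc (Suc m)) + of_real (1 - r) * y m)"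
      using rec[of m] by (simp add: algebra_simps)
    also have "cmod \<dots> \<le> (1 - t) * (r * cmod (y (Suc (Suc m))) + (1 - r) * cmod (y m))"
      unfolding norm_mult using assms(1-4)
      by (intro mult_mono norm_triangle_le add_mono) (auto simp: norm_mult simp del: of_real_diff)
    finally have "cmod (y (Suc m)) \<le> r * cmod (y (Suc (Suc m))) + (1 - r) * cmod (y m)"
      using assms by simp
    then show ?thesis by (simp add: d_def algebra_simps)
  qed
  have grow: "d n \<le> d (n + m)" for m
  proof (induction m)
    case (Suc m)
    have "r * d (n + m) \<le> (1 - r) * d (n + m)"
      using assms Suc pos by (intro mult_right_mono) auto
    with step[of "n + m"] have le: "r * d (n + m) \<le> r * d (Suc (n + m))" by linarith
    have "r \<noteq> 0"
      using step[of "n + m"] Suc pos by auto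
    with le assms Suc show ?case by simp
  qed simp
  have lin: "real m * d n \<le> cmod (y (n + m))" for m
  proof (induction m)
    case (Suc m)
    then show ?case using grow[of m] by (simp add: d_def algebra_simps)
  qed simp
  obtain m where "K < real m * d n"
    using reals_Archimedean3[OF pos] by blast
  with lin[of m] bdd[of "n + m"] show False by linarith
qed

text \<open>
  By monotonicity the boundary equation \<open>(\<mu> - c) y\<^sub>0 = r (1 - t) y\<^sub>1\<close> with
  \<open>c = r t + (1 - r) g\<close> can only be solved by \<open>y\<^sub>0 = 0\<close> as soon as
  \<open>\<bar>\<mu> - c\<bar> > r (1 - t)\<close>. The hypothesis on \<open>g\<close> makes this inequality strict. If \<open>\<bar>g\<bar> < 1\<close>, mass is
  lost at \<open>0\<close>. If \<open>g = 1\<close>, then \<open>r (1 - t) = 1 - c\<close> with \<open>0 < c \<le> 1\<close>, and \<open>1\<close> is the only point of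
  the unit circle that is as close to \<open>c\<close> as that.
\<close>

lemma no_bounded_eigensequence:
  fixes y :: "nat \<Rightarrow> complex" and t r g :: real
  assumes "0 \<le> t" "t < 1" "0 \<le> r" "r \<le> 1/2" "cmod \<mu> = 1"
    and rec: "\<And>n. \<mu> * y (Suc n) = t * y (Suc n) + (1 - t) * (r * y (Suc (Suc n)) + (1 - r) * y n)"
    and bdd: "\<And>n. cmod (y n) \<le> K"
    and init: "\<mu> * y 0 = r * (t * y 0 + (1 - t) * y 1) + (1 - r) * (g * y 0)"
    and g: "\<bar>g\<bar> < 1 \<or> g = 1 \<and> \<mu> \<noteq> 1"
  shows "y n = 0"
proof -
  note mono = bounded_eigensequence_antimono[where y = y and \<mu> = \<mu>, OF assms(1-7)]
  define c where "c = r * t + (1 - r) * g"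
  have "(\<mu> - c) * y 0 = of_real (r * (1 - t)) * y 1"
    using init by (simp add: c_def algebra_simps)
  then have "cmod (\<mu> - c) * cmod (y 0) = r * (1 - t) * cmod (y 1)"
    using assms(1-3) by (metis abs_of_nonneg diff_ge_0_iff_ge less_imp_le mult_nonneg_nonneg norm_mult norm_of_real)
  also have "\<dots> \<le> r * (1 - t) * cmod (y 0)"
    using mono[of 0] assms(1-3) by (intro mult_left_mono) auto
  finally have le: "cmod (\<mu> - c) * cmod (y 0) \<le> r * (1 - t) * cmod (y 0)" .
  have "r * (1 - t) < cmod (\<mu> - c)"
    using g
  proof
    assume "\<bar>g\<bar> < 1"
    then have "(1 - r) * \<bar>g\<bar> < (1 - r) * 1"
      using assms(4) by (intro mult_strict_left_mono) auto
    moreover have "\<bar>c\<bar> \<le> r * t + (1 - r) * \<bar>g\<bar>"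
      unfolding c_def using assms(1-4) by (intro order_trans[OF abs_triangle_ineq]) (simp add: abs_mult)
    moreover have "1 - \<bar>c\<bar> \<le> cmod (\<mu> - c)"
      using norm_triangle_ineq2[of \<mu> "complex_of_real c"] assms(5) by simp
    ultimately show ?thesis by (simp add: algebra_simps)
  next
    assume g1: "g = 1 \<and> \<mu> \<noteq> 1"
    have "r * t \<le> r * 1" using assms(1-3) by (intro mult_left_mono) auto
    moreover have "0 \<le> r * t" using assms by simp
    ultimately have c: "0 < c" "c \<le> 1"
      using g1 assms(4) by (simp_all add: c_def)
    have sq: "(Re \<mu>)\<^sup>2 + (Im \<mu>)\<^sup>2 = 1"
      using cmod_power2[of \<mu>] assms(5) by simp
    have "Re \<mu> < 1"
    proof (rule ccontr)
      assume "\<not> Re \<mu> < 1"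
      then have "Re \<mu> = 1" using complex_Re_le_cmod[of \<mu>] assms(5) by simp
      moreover from this sq have "Im \<mu> = 0" by simp
      ultimately show False using g1 by (simp add: complex_eq_iff)
    qed
    then have "c * Re \<mu> < c * 1" using c by (intro mult_strict_left_mono)
    \<comment> \<open>The squares of \<open>\<bar>\<mu> - c\<bar>\<close> and \<open>1 - c\<close> differ by \<open>2 c (1 - Re \<mu>) > 0\<close>.\<close>
    moreover have "(cmod (\<mu> - c))\<^sup>2 = (Re \<mu>)\<^sup>2 + (Im \<mu>)\<^sup>2 - 2 * (c * Re \<mu>) + c\<^sup>2"
      unfolding cmod_power2 by (simp add: power2_eq_square algebra_simps)
    moreover have "(1 - c)\<^sup>2 = 1 - 2 * c + c\<^sup>2"
      by (simp add: power2_eq_square algebra_simps)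
    ultimately have "(1 - c)\<^sup>2 < (cmod (\<mu> - c))\<^sup>2" using sq by simp
    then have "1 - c < cmod (\<mu> - c)" by (rule power2_less_imp_less) simp
    then show ?thesis using g1 by (simp add: c_def algebra_simps)
  qed
  with le have zero: "y 0 = 0"
    by (metis mult_le_cancel_right norm_eq_zero norm_not_less_zero not_less zero_less_norm_iff)
  show ?thesis
  proof (induction n)
    case (Suc n)
    then show ?case using mono[of n] by simp
  qed (rule zero)
qed

text \<open>
  The interior equation with \<open>\<mu> = 1\<close> is invariant under adding constants, so the monotonicity of the
  modulus applies to \<open>y - y\<^sub>0\<close>, which vanishes at \<open>0\<close>.
\<close>

lemma bounded_fixed_sequence_const:
  fixes y :: "nat \<Rightarrow> complex" and t r :: real
  assumes "0 \<le> t" "t < 1" "0 \<le> r" "r \<le> 1/2"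
    and rec: "\<And>n. y (Suc n) = t * y (Suc n) + (1 - t) * (r * y (Suc (Suc n)) + (1 - r) * y n)"
    and bdd: "\<And>n. cmod (y n) \<le> K"
  shows "y n = y 0"
proof -
  define z where "z n = y n - y 0" for n
  have z_rec: "1 * z (Suc n) = t * z (Suc n) + (1 - t) * (r * z (Suc (Suc n)) + (1 - r) * z n)" for n
    unfolding z_def using rec[of n] by (simp add: algebra_simps)
  have z_bdd: "cmod (z n) \<le> K + K" for n
    unfolding z_def using bdd by (intro norm_triangle_le_diff add_mono)
  have "z n = 0"
  proof (induction n)
    case (Suc n)
    then show ?case
      using bounded_eigensequence_antimono[where y = z and \<mu> = 1, OF assms(1-4) norm_one z_rec z_bdd, of n] by simp
  qed (simp add: z_def)
  then show ?thesis by (simp add: z_def)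
qed

section \<open>Operators supported on one diagonal\<close>

text \<open>
  For unbounded \<open>y\<close> this is \<open>0\<close>, a dummy value inherited from \<open>diag_op\<close>.
\<close>

definition diagonal_op :: "nat \<Rightarrow> (nat \<Rightarrow> complex) \<Rightarrow> ell2_op" where
  "diagonal_op k y = diag_op y * adj shift ^ k"

lemma coord_adj_shift_power: "coord (app (adj shift ^ k) x) n = coord x (n + k)"
  by (induction k arbitrary: n) (simp_all add: coord_adj_shift)

lemma entry_diagonal_op:
  assumes "bounded (range y)"
  shows "entry (diagonal_op k y) i j = (if j = i + k then y i else 0)"
  by (simp add: entry_def diagonal_op_def coord_diag_op[OF assms] coord_adj_shift_power coord_basis)

text \<open>
  Reading off the first row separates the diagonals: among these operators only the one on the
  \<open>k\<close>-th superdiagonal has a nonzero entry at \<open>(0, k)\<close>. The main diagonal is left out because the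
  boundary condition of the walk is different there.
\<close>

lemma independent_diagonal_ops:
  assumes "bounded (range y)" "y 0 \<noteq> 0"
  shows "complex_vector.independent (range (\<lambda>k. diagonal_op (Suc k) y))"
    and "inj (\<lambda>k. diagonal_op (Suc k) y)"
proof -
  let ?x = "\<lambda>k. diagonal_op (Suc k) y"
  note e = entry_diagonal_op[OF assms(1)]
  show inj: "inj ?x"
  proof (rule injI)
    fix k l assume "?x k = ?x l"
    then have "entry (?x k) 0 (Suc k) = entry (?x l) 0 (Suc k)" by simp
    then show "k = l" using assms(2) by (simp add: e split: if_splits)
  qed
  show "complex_vector.independent (range ?x)"
    unfolding complex_vector.dependent_def
  proof clarify
    fix k assume k: "?x k \<in> complex_vector.span (range ?x - {?x k})"
    let ?V = "{z. entry z 0 (Suc k) = 0}"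
    have "complex_vector.span (range ?x - {?x k}) \<subseteq> ?V"
    proof (rule complex_vector.span_minimal)
      show "range ?x - {?x k} \<subseteq> ?V" by (auto simp: e)
      show "complex_vector.subspace ?V" by (auto intro!: complex_vector.subspaceI)
    qed
    with k have "entry (?x k) 0 (Suc k) = 0" by blast
    then show False using assms(2) by (simp add: e)
  qed
qed

section \<open>The constant coupling\<close>

definition constant_transition :: "real \<Rightarrow> real \<Rightarrow> real \<Rightarrow> ell2_op \<Rightarrow> ell2_op" where
  "constant_transition \<alpha> \<beta> lam = transition_op
    (coupling (\<lambda>n. if n = 0 then 1 else \<alpha>) (\<lambda>n. if n = 0 then 0 else \<beta>)) (diag_state lam)"

text \<open>
  With \<open>q = (1 - lam)/lam\<close>, the interior equation with eigenvalue \<open>1\<close> has the solutions \<open>A + B q\<^sup>n\<close>,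
  whatever the laziness. The equation at \<open>0\<close> on an off-diagonal reads
  \<open>(1 - lam) A + (lam (1 + \<alpha>) - (1 - lam) \<alpha>) B = 0\<close> after division by \<open>1 - \<alpha>\<close>, and the choice
  here is \<open>B = -(1 - lam)\<close>. This stays well behaved for \<open>lam = 1\<close>, where the sequence is constant.
\<close>

definition walk_harmonic :: "real \<Rightarrow> real \<Rightarrow> nat \<Rightarrow> real" where
  "walk_harmonic \<alpha> lam n = lam + (2 * lam - 1) * \<alpha> - (1 - lam) * ((1 - lam) / lam) ^ n"

context
  fixes \<alpha> \<beta> lam :: real
  assumes \<alpha>\<beta>: "\<alpha>\<^sup>2 + \<beta>\<^sup>2 = 1" and \<beta>: "\<beta> \<noteq> 0"
begin

abbreviation "T \<equiv> constant_transition \<alpha> \<beta> lam"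
abbreviation "harmonic \<equiv> walk_harmonic \<alpha> lam"

lemma abs_alpha_less_1: "\<bar>\<alpha>\<bar> < 1" "\<alpha>\<^sup>2 < 1"
proof -
  show "\<alpha>\<^sup>2 < 1" using \<alpha>\<beta> \<beta> zero_less_power2[of \<beta>] by linarith
  then show "\<bar>\<alpha>\<bar> < 1" by (simp add: abs_square_less_1)
qed

text \<open>
  The laziness \<open>\<alpha>\<^sup>2\<close> appears twice in the interior, with weights \<open>lam\<close> and \<open>1 - lam\<close> that add up to
  \<open>1\<close>. In the first row and column the second contribution is different because the
  sequence \<open>\<alpha>\<^sub>n\<close> starts with \<open>1\<close>, and there is no step down.
\<close>

lemma entry_T:
  "entry (T x) (Suc i) (Suc j) = complex_of_real (\<alpha>\<^sup>2) * entry x (Suc i) (Suc j)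
    + (1 - \<alpha>\<^sup>2) * (lam * entry x (Suc (Suc i)) (Suc (Suc j)) + (1 - lam) * entry x i j)"
  "i = 0 \<or> j = 0 \<Longrightarrow> entry (T x) i j =
    lam * (complex_of_real (\<alpha>\<^sup>2) * entry x i j + (1 - \<alpha>\<^sup>2) * entry x (Suc i) (Suc j))
    + (1 - lam) * ((if i = j then 1 else \<alpha>) * entry x i j)"
proof -
  have \<beta>2: "complex_of_real \<beta> * complex_of_real \<beta> = 1 - complex_of_real \<alpha> * complex_of_real \<alpha>"
    using arg_cong[OF \<alpha>\<beta>, of complex_of_real] by (simp add: power2_eq_square algebra_simps)
  have bdd: "bounded (range (\<lambda>n::nat. complex_of_real (if n = 0 then c else d)))" for c d
    by (rule finite_imp_bounded, rule finite_subset[of _ "{of_real c, of_real d}"]) auto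
  show "entry (T x) (Suc i) (Suc j) = complex_of_real (\<alpha>\<^sup>2) * entry x (Suc i) (Suc j)
    + (1 - \<alpha>\<^sup>2) * (lam * entry x (Suc (Suc i)) (Suc (Suc j)) + (1 - lam) * entry x i j)"
    unfolding constant_transition_def by (simp add: entry_transition_op[OF bdd bdd] \<beta>2 power2_eq_square algebra_simps)
  show "entry (T x) i j =
    lam * (complex_of_real (\<alpha>\<^sup>2) * entry x i j + (1 - \<alpha>\<^sup>2) * entry x (Suc i) (Suc j))
    + (1 - lam) * ((if i = j then 1 else \<alpha>) * entry x i j)" if "i = 0 \<or> j = 0"
    unfolding constant_transition_def using that
    by (auto simp: entry_transition_op[OF bdd bdd] \<beta>2 power2_eq_square algebra_simps)
qed

lemma T_scaleC_one: "T (c *\<^sub>C 1) = c *\<^sub>C 1"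
proof (rule ell2_op_eqI_entry)
  fix i j
  have convex: "z * c + (1 - z) * c = c" for z by (simp add: algebra_simps)
  show "entry (T (c *\<^sub>C 1)) i j = entry (c *\<^sub>C 1) i j"
    by (cases i; cases j; cases "i = j") (simp_all add: entry_T entry_one convex)
qed

text \<open>
  Every diagonal starts in the first row or the first column, say at \<open>(p, q)\<close>. It carries no bounded
  eigensequence at all, except for the constants on the main diagonal when \<open>\<mu> = 1\<close>.
\<close>

lemma weakly_mixing_T:
  assumes lam: "0 \<le> lam" "lam \<le> 1/2"
  shows "weakly_mixing T"
  unfolding weakly_mixing_def
proof clarify
  fix x \<mu> assume \<mu>: "cmod \<mu> = 1" and eig: "T x = \<mu> *\<^sub>C x"
  obtain K where K: "\<And>i j. cmod (entry x i j) \<le> K"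
    by (rule entry_bounded[of x]) blast
  have "entry (T x) i j = \<mu> * entry x i j" for i j using eig by simp
  note rec = entry_T[where x = x, unfolded this]
  have vanish: "entry x (p + n) (q + n) = 0"
    if "p = 0 \<or> q = 0" "p \<noteq> q \<or> \<mu> \<noteq> 1" for p q n
  proof (rule no_bounded_eigensequence[where y = "\<lambda>n. entry x (p + n) (q + n)" and \<mu> = \<mu>
        and t = "\<alpha>\<^sup>2" and r = lam and K = K and g = "if p = q then 1 else \<alpha>"])
    show "\<mu> * entry x (p + Suc m) (q + Suc m) = complex_of_real (\<alpha>\<^sup>2) * entry x (p + Suc m) (q + Suc m)
        + complex_of_real (1 - \<alpha>\<^sup>2) * (complex_of_real lam * entry x (p + Suc (Suc m)) (q + Suc (Suc m))
        + complex_of_real (1 - lam) * entry x (p + m) (q + m))" for m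
      using rec(1)[of "p + m" "q + m"] by (simp only: add_Suc_right)
    show "\<mu> * entry x (p + 0) (q + 0) = complex_of_real lam * (complex_of_real (\<alpha>\<^sup>2) * entry x (p + 0) (q + 0)
        + complex_of_real (1 - \<alpha>\<^sup>2) * entry x (p + 1) (q + 1))
        + complex_of_real (1 - lam) * (complex_of_real (if p = q then 1 else \<alpha>) * entry x (p + 0) (q + 0))"
      using rec(2)[OF that(1)] by (simp only: add_0_right Suc_eq_plus1)
    show "\<bar>if p = q then 1 else \<alpha>\<bar> < 1 \<or> (if p = q then 1 else \<alpha>) = 1 \<and> \<mu> \<noteq> 1"
      using that(2) abs_alpha_less_1(1) by auto
  qed (use abs_alpha_less_1(2) lam \<mu> K in auto)
  have const: "entry x n n = entry x 0 0" if "\<mu> = 1" for n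
    by (rule bounded_fixed_sequence_const[where y = "\<lambda>n. entry x n n" and t = "\<alpha>\<^sup>2" and r = lam and K = K])
      (use zero_le_power2 abs_alpha_less_1(2) lam K rec(1)[unfolded that mult_1] in blast)+
  have "entry x i j = entry (entry x 0 0 *\<^sub>C 1) i j" for i j
  proof -
    \<comment> \<open>The distance of \<open>(i, j)\<close> from the start of its diagonal.\<close>
    define n where "n = min i j"
    have ij: "i = (i - n) + n" "j = (j - n) + n" "i - n = 0 \<or> j - n = 0"
      by (auto simp: n_def)
    show ?thesis
    proof (cases "i = j \<and> \<mu> = 1")
      case True
      then show ?thesis using const[of i] by (simp add: entry_one)
    next
      case False
      then have "entry x i j = 0"
        using vanish[OF ij(3), of n] ij(1,2) by (metis)
      moreover have "\<mu> \<noteq> 1 \<Longrightarrow> entry x 0 0 = 0" using vanish[of 0 0 0] by simp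
      ultimately show ?thesis using False by (auto simp: entry_one)
    qed
  qed
  then have "x = entry x 0 0 *\<^sub>C 1" by (rule ell2_op_eqI_entry)
  then show "x \<in> range (\<lambda>c. c *\<^sub>C 1)" by blast
qed

lemma bounded_harmonic:
  assumes "1/2 < lam" "lam \<le> 1"
  shows "bounded (range (\<lambda>n. complex_of_real (harmonic n)))"
proof -
  let ?q = "(1 - lam) / lam"
  have q: "0 \<le> ?q" "?q \<le> 1" using assms by (simp_all add: divide_simps)
  have "\<bar>harmonic n\<bar> \<le> \<bar>lam + (2 * lam - 1) * \<alpha>\<bar> + (1 - lam)" for n
  proof -
    have "?q ^ n \<le> 1" "0 \<le> ?q ^ n" using q by (auto intro: power_le_one)
    then have "0 \<le> (1 - lam) * ?q ^ n" "(1 - lam) * ?q ^ n \<le> 1 - lam"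
      using assms mult_left_mono[of "?q ^ n" 1 "1 - lam"] by (auto simp del: power_divide)
    then show ?thesis unfolding walk_harmonic_def by linarith
  qed
  then show ?thesis by (auto simp: bounded_iff)
qed

lemma harmonic_0:
  assumes "1/2 < lam"
  shows "harmonic 0 \<noteq> 0"
proof -
  have "harmonic 0 = (2 * lam - 1) * (1 + \<alpha>)" by (simp add: walk_harmonic_def algebra_simps)
  then show ?thesis using assms abs_alpha_less_1(1) by auto
qed

lemma harmonic_rec:
  assumes "1/2 < lam"
  shows "harmonic (Suc n) = \<alpha>\<^sup>2 * harmonic (Suc n) + (1 - \<alpha>\<^sup>2) * (lam * harmonic (Suc (Suc n)) + (1 - lam) * harmonic n)"
    and "harmonic 0 = lam * (\<alpha>\<^sup>2 * harmonic 0 + (1 - \<alpha>\<^sup>2) * harmonic 1) + (1 - lam) * (\<alpha> * harmonic 0)"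
proof -
  define q where "q = (1 - lam) / lam"
  have q: "lam * q = 1 - lam" using assms by (simp add: q_def)
  have "lam * harmonic (Suc (Suc n)) + (1 - lam) * harmonic n - harmonic (Suc n)
      = - (1 - lam) * q ^ n * ((lam * q) * q + (1 - lam) - q)"
    unfolding walk_harmonic_def q_def[symmetric] by (simp add: algebra_simps)
  also have "(lam * q) * q + (1 - lam) - q = 0"
    unfolding q using q by (simp add: algebra_simps)
  finally have "lam * harmonic (Suc (Suc n)) + (1 - lam) * harmonic n = harmonic (Suc n)" by simp
  then show "harmonic (Suc n) = \<alpha>\<^sup>2 * harmonic (Suc n) + (1 - \<alpha>\<^sup>2) * (lam * harmonic (Suc (Suc n)) + (1 - lam) * harmonic n)"
    by (simp add: algebra_simps)
  have "lam * harmonic 1 = lam * (lam + (2 * lam - 1) * \<alpha>) - (1 - lam) * (lam * q)"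
    unfolding walk_harmonic_def q_def[symmetric] by (simp add: algebra_simps)
  also have "\<dots> = (2 * lam - 1) * (1 + lam * \<alpha>)"
    unfolding q by (simp add: algebra_simps power2_eq_square)
  finally have h1: "lam * harmonic 1 = (2 * lam - 1) * (1 + lam * \<alpha>)" .
  have h0: "harmonic 0 = (2 * lam - 1) * (1 + \<alpha>)" by (simp add: walk_harmonic_def algebra_simps)
  have "lam * (\<alpha>\<^sup>2 * harmonic 0 + (1 - \<alpha>\<^sup>2) * harmonic 1) + (1 - lam) * (\<alpha> * harmonic 0)
    = (lam * \<alpha>\<^sup>2 + (1 - lam) * \<alpha>) * harmonic 0 + (1 - \<alpha>\<^sup>2) * (lam * harmonic 1)"
    by (simp add: algebra_simps)
  also have "\<dots> = harmonic 0"
    unfolding h0 h1 by (simp add: algebra_simps power2_eq_square)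
  finally show "harmonic 0 = lam * (\<alpha>\<^sup>2 * harmonic 0 + (1 - \<alpha>\<^sup>2) * harmonic 1) + (1 - lam) * (\<alpha> * harmonic 0)" by simp
qed

lemma harmonic_diagonal_fixed:
  assumes "1/2 < lam" "lam \<le> 1"
  shows "diagonal_op (Suc k) (\<lambda>n. complex_of_real (harmonic n)) \<in> fixed_space T"
  unfolding fixed_space_def mem_Collect_eq
proof (rule ell2_op_eqI_entry)
  fix i j
  note e = entry_diagonal_op[OF bounded_harmonic[OF assms]]
  note rec = harmonic_rec[OF assms(1), THEN arg_cong[where f = complex_of_real], symmetric]
  show "entry (T (diagonal_op (Suc k) (\<lambda>n. complex_of_real (harmonic n)))) i j
      = entry (diagonal_op (Suc k) (\<lambda>n. complex_of_real (harmonic n))) i j"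
    using rec(1)[of "i - 1"] rec(2) by (cases i; cases j) (auto simp: entry_T e)
qed

lemma infinite_dimensional_fixed_space:
  assumes "1/2 < lam" "lam \<le> 1"
  shows "\<not> finite_dimensionalC (fixed_space T)"
proof
  assume "finite_dimensionalC (fixed_space T)"
  then obtain B where B: "finite B" "fixed_space T = complex_vector.span B"
    by (auto simp: finite_dimensionalC_def)
  let ?x = "\<lambda>k. diagonal_op (Suc k) (\<lambda>n. complex_of_real (harmonic n))"
  have "complex_of_real (harmonic 0) \<noteq> 0" using harmonic_0[OF assms(1)] by simp
  note ind = independent_diagonal_ops[OF bounded_harmonic[OF assms] this]
  have "range ?x \<subseteq> complex_vector.span B" using harmonic_diagonal_fixed[OF assms] B by auto
  then have "finite (range ?x)"
    using complex_vector.independent_span_bound[OF B(1) ind(1)] by blast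
  then show False using ind(2) finite_imageD by blast
qed

lemma weakly_mixing_imp_ergodic: "weakly_mixing T \<Longrightarrow> ergodic T"
  unfolding weakly_mixing_def ergodic_def fixed_space_def
  using T_scaleC_one by (auto simp: scaleC_one) (metis norm_one scaleC_one)

text \<open>
  Hence an infinite-dimensional fixed space excludes ergodicity, and with it weak mixing.
\<close>

lemma ergodic_imp_finite_dimensional: "ergodic T \<Longrightarrow> finite_dimensionalC (fixed_space T)"
  unfolding ergodic_def finite_dimensionalC_def
  by (intro exI[of _ "{1}"]) (simp add: complex_vector.span_singleton)

end

theorem proposition5p3:
  fixes \<alpha> \<beta> lam :: real
  assumes "\<alpha> \<in> {-1..1}" and "\<beta> \<in> {-1..1}" and "\<alpha>\<^sup>2 + \<beta>\<^sup>2 = 1" and "\<beta> \<noteq> 0"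
    and "0 \<le> lam" and "lam \<le> 1"
  defines "u \<equiv> coupling (\<lambda>n. if n = 0 then 1 else \<alpha>) (\<lambda>n. if n = 0 then 0 else \<beta>)"
    and "\<psi> \<equiv> diag_state lam"
  shows "(weakly_mixing (transition_op u \<psi>) \<longleftrightarrow> lam \<le> 1/2)
    \<and> (weakly_mixing (transition_op u \<psi>) \<longrightarrow> ergodic (transition_op u \<psi>))
    \<and> (lam > 1/2 \<longrightarrow> \<not> finite_dimensionalC (fixed_space (transition_op u \<psi>)))"
proof -
  note \<alpha>\<beta> = assms(3,4)
  have T: "transition_op u \<psi> = constant_transition \<alpha> \<beta> lam"
    by (simp add: constant_transition_def u_def \<psi>_def)
  note mix = weakly_mixing_T[OF \<alpha>\<beta> assms(5)]
  note erg = weakly_mixing_imp_ergodic[OF \<alpha>\<beta>, of lam]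
  note inf = infinite_dimensional_fixed_space[OF \<alpha>\<beta> _ assms(6)]
  note fin = ergodic_imp_finite_dimensional[OF \<alpha>\<beta>, of lam]
  show ?thesis unfolding T using mix erg inf fin by (meson not_le)
qed

end
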